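(* Let $1<p<\infty$ and $0\leq\lambda<n$. Then any $p$-admissible sublinear singular type operator $T$ is bounded in $V_\infty L^{p,\lambda}(\mathbb{R}^n)$; that is, $Tf\in V_\infty L^{p,\lambda}(\mathbb{R}^n)$ for every $f\in V_\infty L^{p,\lambda}(\mathbb{R}^n)$ and there is a constant $C>0$ such that $\|Tf\|_{p,\lambda}\leq C\,\|f\|_{p,\lambda}$ for all $f\in V_\infty L^{p,\lambda}(\mathbb{R}^n)$.
   Context: For $x\in\mathbb{R}^n$, $r>0$, let $B(x,r)$ be the open ball and $\mathfrak{M}_{p,\lambda}(f;x,r):=\frac{1}{r^\lambda}\int_{B(x,r)}|f(y)|^p\,dy$. The Morrey space $L^{p,\lambda}(\mathbb{R}^n)$ consists of all locally $p$-integrable $f$ on $\mathbb{R}^n$ with $\|f\|_{p,\lambda}:=\sup_{x\in\mathbb{R}^n,\,r>0}\mathfrak{M}_{p,\lambda}(f;x,r)^{1/p}<\infty$. The subspace $V_\infty L^{p,\lambda}(\mathbb{R}^n)$ consists of all $f\in L^{p,\lambda}(\mathbb{R}^n)$ with $\lim_{r\to\infty}\sup_{x\in\mathbb{R}^n}\mathfrak{M}_{p,\lambda}(f;x,r)=0$. For $1<p<\infty$, a sublinear operator $T$ (mapping functions to measurable functions, $|T(f+g)|\le|Tf|+|Tg|$ and $|T(cf)|=|c||Tf|$ a.e.) is called a $p$-admissible singular type operator if it is bounded in $L^p(\mathbb{R}^n)$ and satisfies the size condition: there is a constant $c>0$, independent of $f$, $x$, $r$, $z$, such that $$\chi_{B(x,r)}(z)\,\left|T\left(f\,\chi_{\mathbb{R}^n\setminus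 B(x,2r)}\right)(z)\right|\leq c\,\chi_{B(x,r)}(z)\int_{\mathbb{R}^n\setminus B(x,2r)}\frac{|f(y)|}{|y-z|^n}\,dy$$ for every $x\in\mathbb{R}^n$, $r>0$ and almost every $z$. It is understood that $T$ is defined on all functions under consideration (in particular on functions in $L^p(\mathbb{R}^n)$, in $L^{p,\lambda}(\mathbb{R}^n)$, and on their restrictions to measurable sets), and that the size condition holds for all such $f$. *)

theory Defs
  imports "HOL-Analysis.Analysis"
begin

text \<open>
  Functions are defined on \<open>real ^ 'n\<close>, so the dimension is \<open>CARD('n)\<close>, and take values in
  \<open>'b :: {real_normed_field, euclidean_space}\<close>, which covers both real and complex scalars.
  Measurability and integration are with respect to Lebesgue measure, and we work with functions
  rather than with classes modulo null sets.
\<close>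

definition Lp_space :: "real \<Rightarrow> (real ^ 'n \<Rightarrow> 'b::{real_normed_field, euclidean_space}) set" where
  "Lp_space p = {f \<in> borel_measurable lebesgue. integrable lebesgue (\<lambda>y. norm (f y) powr p)}"

definition Lp_norm :: "real \<Rightarrow> (real ^ 'n \<Rightarrow> 'b::{real_normed_field, euclidean_space}) \<Rightarrow> real" where
  "Lp_norm p f = (LINT y|lebesgue. norm (f y) powr p) powr (1 / p)"

definition locally_p_integrable ::
    "real \<Rightarrow> (real ^ 'n \<Rightarrow> 'b::{real_normed_field, euclidean_space}) \<Rightarrow> bool" where
  "locally_p_integrable p f \<longleftrightarrow> f \<in> borel_measurable lebesgue \<and>
     (\<forall>K. compact K \<longrightarrow> set_integrable lebesgue K (\<lambda>y. norm (f y) powr p))"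

definition morrey_modulus ::
    "real \<Rightarrow> real \<Rightarrow> (real ^ 'n \<Rightarrow> 'b::{real_normed_field, euclidean_space}) \<Rightarrow>
     real ^ 'n \<Rightarrow> real \<Rightarrow> real" where
  "morrey_modulus p l f x r =
     1 / r powr l * (LINT y:ball x r|lebesgue. norm (f y) powr p)"

text \<open>The real-valued supremum below is meaningful only on \<open>morrey_space p l\<close>, where the set is
  bounded.\<close>

definition morrey_norm ::
    "real \<Rightarrow> real \<Rightarrow> (real ^ 'n \<Rightarrow> 'b::{real_normed_field, euclidean_space}) \<Rightarrow> real" where
  "morrey_norm p l f =
     (SUP (x, r) \<in> UNIV \<times> {0<..}. morrey_modulus p l f x r powr (1 / p))"

definition morrey_space ::
    "real \<Rightarrow> real \<Rightarrow> (real ^ 'n \<Rightarrow> 'b::{real_normed_field, euclidean_space}) set" where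
  "morrey_space p l = {f. locally_p_integrable p f \<and>
     bdd_above ((\<lambda>(x, r). morrey_modulus p l f x r powr (1 / p)) ` (UNIV \<times> {0<..}))}"

definition vanishing_morrey_space_infty ::
    "real \<Rightarrow> real \<Rightarrow> (real ^ 'n \<Rightarrow> 'b::{real_normed_field, euclidean_space}) set" where
  "vanishing_morrey_space_infty p l = {f \<in> morrey_space p l.
     ((\<lambda>r. SUP x. morrey_modulus p l f x r) \<longlongrightarrow> 0) at_top}"

text \<open>
  An operator is a total function of which only the values on its domain \<open>D\<close> matter. Hence each
  condition is imposed only when every function to which \<open>T\<close> is applied lies in \<open>D\<close>; no closure
  properties of \<open>D\<close> are required.
\<close>

definition sublinear_on ::
    "(real ^ 'n \<Rightarrow> 'b::{real_normed_field, euclidean_space}) set \<Rightarrow>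
     ((real ^ 'n \<Rightarrow> 'b) \<Rightarrow> real ^ 'n \<Rightarrow> 'b) \<Rightarrow> bool" where
  "sublinear_on D T \<longleftrightarrow>
     (\<forall>f\<in>D. T f \<in> borel_measurable lebesgue) \<and>
     (\<forall>f\<in>D. \<forall>g\<in>D. (\<lambda>y. f y + g y) \<in> D \<longrightarrow>
        (AE z in lebesgue. norm (T (\<lambda>y. f y + g y) z) \<le> norm (T f z) + norm (T g z))) \<and>
     (\<forall>f\<in>D. \<forall>a. (\<lambda>y. a * f y) \<in> D \<longrightarrow>
        (AE z in lebesgue. norm (T (\<lambda>y. a * f y) z) = norm a * norm (T f z)))"

definition Lp_bounded ::
    "real \<Rightarrow> ((real ^ 'n \<Rightarrow> 'b::{real_normed_field, euclidean_space}) \<Rightarrow> real ^ 'n \<Rightarrow> 'b) \<Rightarrow> bool" where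
  "Lp_bounded p T \<longleftrightarrow>
     (\<forall>f\<in>Lp_space p. T f \<in> Lp_space p) \<and>
     (\<exists>C>0. \<forall>f\<in>Lp_space p. Lp_norm p (T f) \<le> C * Lp_norm p f)"

definition restrict_fun ::
    "(real ^ 'n) set \<Rightarrow> (real ^ 'n \<Rightarrow> 'b::{real_normed_field, euclidean_space}) \<Rightarrow> real ^ 'n \<Rightarrow> 'b" where
  "restrict_fun A f = (\<lambda>y. indicator A y *\<^sub>R f y)"

text \<open>The right-hand side is an integral in \<open>[0, \<infinity>]\<close>, so that the condition is void, instead of
  forcing \<open>T\<close> to vanish, where the integral diverges.\<close>

definition size_condition_on ::
    "(real ^ 'n \<Rightarrow> 'b::{real_normed_field, euclidean_space}) set \<Rightarrow>
     ((real ^ 'n \<Rightarrow> 'b) \<Rightarrow> real ^ 'n \<Rightarrow> 'b) \<Rightarrow> bool" where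
  "size_condition_on D T \<longleftrightarrow> (\<exists>c::real. c > 0 \<and>
     (\<forall>f\<in>D. \<forall>x r. r > 0 \<longrightarrow> restrict_fun (- ball x (2 * r)) f \<in> D \<longrightarrow>
       (AE z in lebesgue.
          indicator (ball x r) z * ennreal (norm (T (restrict_fun (- ball x (2 * r)) f) z))
          \<le> ennreal c * indicator (ball x r) z *
              (\<integral>\<^sup>+ y \<in> - ball x (2 * r). ennreal (norm (f y) / norm (y - z) ^ CARD('n)) \<partial>lebesgue))))"

definition p_admissible_singular ::
    "real \<Rightarrow> (real ^ 'n \<Rightarrow> 'b::{real_normed_field, euclidean_space}) set \<Rightarrow>
     ((real ^ 'n \<Rightarrow> 'b) \<Rightarrow> real ^ 'n \<Rightarrow> 'b) \<Rightarrow> bool" where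
  "p_admissible_singular p D T \<longleftrightarrow>
     sublinear_on D T \<and> Lp_bounded p T \<and> size_condition_on D T"

end

theory Submission
  imports Defs
begin

text \<open>
  Split \<open>f = g + h\<close> with \<open>g\<close> supported in \<open>ball x (2 * r)\<close>. The \<open>L\<^sup>p\<close> bound controls \<open>T g\<close>. For
  \<open>T h\<close>, cutting the integral of the size condition into dyadic annuli around \<open>x\<close> gives a geometric
  series, convergent because \<open>l < n\<close>. Altogether, if all moduli of \<open>f\<close> at radii \<open>s \<ge> 2 * r\<close> are at
  most \<open>K powr p\<close>, then those of \<open>T f\<close> at radius \<open>r\<close> are at most \<open>(C * K) powr p\<close>. Since
  only larger radii enter, this yields both the norm bound and the decay as \<open>r \<rightarrow> \<infinity>\<close>.
\<close>

section \<open>Morrey moduli and integrals in [0, \<infinity>]\<close>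

lemma ball_in_sets_lebesgue [measurable]: "ball (x::'a::euclidean_space) r \<in> sets lebesgue"
  by simp

lemma morrey_modulus_nonneg: "0 \<le> morrey_modulus p l f x r"
  unfolding morrey_modulus_def set_lebesgue_integral_def
  by (intro mult_nonneg_nonneg integral_nonneg_AE) auto

lemma locally_p_integrable_set_integrable_ball:
  assumes "locally_p_integrable p f"
  shows "set_integrable lebesgue (ball x r) (\<lambda>y. norm (f y) powr p)"
proof (rule set_integrable_subset)
  show "set_integrable lebesgue (cball x r) (\<lambda>y. norm (f y) powr p)"
    using assms by (simp add: locally_p_integrable_def)
qed (auto simp: subset_iff)

text \<open>Every compact set lies in a ball around 0, so integrability on balls, which is what the
  Morrey estimates provide, is enough.\<close>

lemma locally_p_integrableI_ball:
  fixes f :: "real ^ 'n \<Rightarrow> 'b::{real_normed_field, euclidean_space}"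
  assumes "f \<in> borel_measurable lebesgue"
    and "\<And>r. r > 0 \<Longrightarrow> set_integrable lebesgue (ball 0 r) (\<lambda>y. norm (f y) powr p)"
  shows "locally_p_integrable p f"
  unfolding locally_p_integrable_def
proof (intro conjI allI impI assms(1))
  fix K :: "(real ^ 'n) set"
  assume "compact K"
  then obtain r where r: "r > 0" "K \<subseteq> ball 0 r"
    using bounded_subset_ballD[OF compact_imp_bounded] by blast
  then show "set_integrable lebesgue K (\<lambda>y. norm (f y) powr p)"
    using \<open>compact K\<close>
    by (intro set_integrable_subset[OF assms(2)]) (auto dest: lmeasurable_compact)
qed

text \<open>Passage to integrals in [0, \<infinity>], where the estimates run without integrability
  side conditions. Local integrability makes both kinds of integral agree.\<close>

lemma nn_integral_ball_eq_morrey_modulus: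
  assumes "locally_p_integrable p f" and "r > 0"
  shows "(\<integral>\<^sup>+ y \<in> ball x r. ennreal (norm (f y) powr p) \<partial>lebesgue)
    = ennreal (r powr l * morrey_modulus p l f x r)"
proof -
  have "(\<integral>\<^sup>+ y \<in> ball x r. ennreal (norm (f y) powr p) \<partial>lebesgue)
    = (\<integral>\<^sup>+ y. ennreal (indicator (ball x r) y *\<^sub>R norm (f y) powr p) \<partial>lebesgue)"
    by (intro nn_integral_cong) (auto simp: indicator_def)
  also have "\<dots> = ennreal (LINT y:ball x r|lebesgue. norm (f y) powr p)"
    unfolding set_lebesgue_integral_def
    using locally_p_integrable_set_integrable_ball[OF assms(1), of x r]
    by (intro nn_integral_eq_integral) (auto simp: set_integrable_def)
  finally show ?thesis
    using assms(2) by (simp add: morrey_modulus_def)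
qed

text \<open>The way back. Only measurability is assumed, because for \<open>T f\<close>
  integrability is itself to be shown; it must come along with the bound, since the Bochner integral
  of a non-integrable function is 0 by default.\<close>

lemma morrey_modulus_le_of_nn_integral:
  assumes "f \<in> borel_measurable lebesgue" and "r > 0" and "0 \<le> A"
    and le: "(\<integral>\<^sup>+ y \<in> ball x r. ennreal (norm (f y) powr p) \<partial>lebesgue) \<le> ennreal (r powr l * A)"
  shows "set_integrable lebesgue (ball x r) (\<lambda>y. norm (f y) powr p)"
    and "morrey_modulus p l f x r \<le> A"
proof -
  have [measurable]: "f \<in> borel_measurable lebesgue" by fact
  have eq: "(\<integral>\<^sup>+ y. ennreal (indicator (ball x r) y *\<^sub>R norm (f y) powr p) \<partial>lebesgue)
    = (\<integral>\<^sup>+ y \<in> ball x r. ennreal (norm (f y) powr p) \<partial>lebesgue)"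
    by (intro nn_integral_cong) (auto simp: indicator_def)
  show int: "set_integrable lebesgue (ball x r) (\<lambda>y. norm (f y) powr p)"
    unfolding set_integrable_def
  proof (rule integrableI_nonneg)
    show "(\<lambda>y. indicator (ball x r) y *\<^sub>R norm (f y) powr p) \<in> borel_measurable lebesgue"
      by measurable
    show "(\<integral>\<^sup>+ y. ennreal (indicator (ball x r) y *\<^sub>R norm (f y) powr p) \<partial>lebesgue) < \<infinity>"
      using le unfolding eq by (auto intro: le_less_trans)
  qed auto
  have "ennreal (LINT y:ball x r|lebesgue. norm (f y) powr p) \<le> ennreal (r powr l * A)"
    using le int unfolding eq[symmetric] set_lebesgue_integral_def set_integrable_def
    by (subst nn_integral_eq_integral[symmetric]) auto
  then have "(LINT y:ball x r|lebesgue. norm (f y) powr p) \<le> r powr l * A"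
    using assms by (subst (asm) ennreal_le_iff) auto
  then show "morrey_modulus p l f x r \<le> A"
    using \<open>r > 0\<close> by (simp add: morrey_modulus_def field_simps)
qed

section \<open>Restrictions and membership in the Morrey space\<close>

lemma restrict_fun_measurable:
  assumes [measurable]: "f \<in> borel_measurable lebesgue" "A \<in> sets lebesgue"
  shows "restrict_fun A f \<in> borel_measurable lebesgue"
  unfolding restrict_fun_def by measurable

lemma norm_restrict_fun_powr:
  "norm (restrict_fun A f y) powr p = indicator A y * norm (f y) powr p"
  by (simp add: restrict_fun_def indicator_def)

lemma restrict_fun_add_compl:
  "(\<lambda>y. restrict_fun A f y + restrict_fun (- A) f y) = f"
  by (auto simp: restrict_fun_def indicator_def)

lemma restrict_fun_ball_in_Lp_space:
  assumes "locally_p_integrable p f"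
  shows "restrict_fun (ball x r) f \<in> Lp_space p"
  using assms locally_p_integrable_set_integrable_ball[OF assms, of x r]
  by (auto simp: Lp_space_def norm_restrict_fun_powr set_integrable_def locally_p_integrable_def
      intro!: restrict_fun_measurable)

lemma morrey_spaceI:
  fixes f :: "real ^ 'n \<Rightarrow> 'b::{real_normed_field, euclidean_space}"
  assumes "1 < p" and "locally_p_integrable p f"
    and "\<And>x r. r > 0 \<Longrightarrow> morrey_modulus p l f x r \<le> B"
  shows "f \<in> morrey_space p l"
  unfolding morrey_space_def
proof (intro CollectI conjI assms(2) bdd_aboveI2[where M = "B powr (1 / p)"])
  fix z :: "(real ^ 'n) \<times> real"
  assume "z \<in> UNIV \<times> {0<..}"
  then show "(case z of (x, r) \<Rightarrow> morrey_modulus p l f x r powr (1 / p)) \<le> B powr (1 / p)"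
    using assms by (auto intro!: powr_mono2 morrey_modulus_nonneg)
qed

lemma morrey_modulus_le_norm:
  assumes "1 < p" and "f \<in> morrey_space p l" and "r > 0"
  shows "morrey_modulus p l f x r powr (1 / p) \<le> morrey_norm p l f"
    and "morrey_modulus p l f x r \<le> morrey_norm p l f powr p"
proof -
  show *: "morrey_modulus p l f x r powr (1 / p) \<le> morrey_norm p l f"
    unfolding morrey_norm_def
    using assms by (intro cSUP_upper2[where x = "(x, r)"]) (auto simp: morrey_space_def)
  have "(morrey_modulus p l f x r powr (1 / p)) powr p \<le> morrey_norm p l f powr p"
    using assms(1) * by (intro powr_mono2) auto
  then show "morrey_modulus p l f x r \<le> morrey_norm p l f powr p"
    using assms(1) by (simp add: powr_powr morrey_modulus_nonneg)
qed

text \<open>Restriction only decreases the norm pointwise. This puts the far part of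
  \<open>f\<close> into the domain of the operator.\<close>

lemma restrict_fun_in_morrey_space:
  assumes "1 < p" and f: "f \<in> morrey_space p l" and A: "A \<in> sets lebesgue"
  shows "restrict_fun A f \<in> morrey_space p l"
proof -
  have loc: "locally_p_integrable p f"
    using f by (simp add: morrey_space_def)
  have meas: "restrict_fun A f \<in> borel_measurable lebesgue"
    using loc A by (auto simp: locally_p_integrable_def intro: restrict_fun_measurable)
  have bound: "(\<integral>\<^sup>+ y \<in> ball x r. ennreal (norm (restrict_fun A f y) powr p) \<partial>lebesgue)
      \<le> ennreal (r powr l * morrey_norm p l f powr p)" if "r > 0" for x r
  proof -
    have "(\<integral>\<^sup>+ y \<in> ball x r. ennreal (norm (restrict_fun A f y) powr p) \<partial>lebesgue)
      \<le> (\<integral>\<^sup>+ y \<in> ball x r. ennreal (norm (f y) powr p) \<partial>lebesgue)"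
      unfolding norm_restrict_fun_powr
      by (intro nn_integral_mono) (auto simp: indicator_def)
    also have "\<dots> \<le> ennreal (r powr l * morrey_norm p l f powr p)"
      unfolding nn_integral_ball_eq_morrey_modulus[OF loc that, of x l]
      using morrey_modulus_le_norm(2)[OF assms(1,2) that]
      by (intro ennreal_leI mult_left_mono) auto
    finally show ?thesis .
  qed
  note * = morrey_modulus_le_of_nn_integral[OF meas _ _ bound]
  show ?thesis
    by (rule morrey_spaceI[OF assms(1) locally_p_integrableI_ball[OF meas *(1)] *(2)]) auto
qed

section \<open>Elementary inequalities and integrals over balls\<close>

lemma powr_add_le:
  fixes a b p :: real
  assumes "0 \<le> a" "0 \<le> b" "0 \<le> p"
  shows "(a + b) powr p \<le> 2 powr p * (a powr p + b powr p)"
proof -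
  have "(a + b) powr p \<le> (2 * max a b) powr p"
    using assms by (intro powr_mono2) auto
  also have "\<dots> = 2 powr p * max a b powr p"
    using assms by (simp add: powr_mult)
  also have "\<dots> \<le> 2 powr p * (a powr p + b powr p)"
    by (intro mult_left_mono) (auto simp: max_def)
  finally show ?thesis .
qed

text \<open>If \<open>u\<close> exceeds \<open>t\<close>, write \<open>u\<close> as
  \<open>u powr (1 - p) * u powr p\<close>; the exponent \<open>1 - p\<close> is nonpositive, so
  replacing its base by \<open>t\<close> increases the product.\<close>

lemma le_add_powr_scaled:
  fixes u t p :: real
  assumes "0 \<le> u" "0 < t" "1 \<le> p"
  shows "u \<le> t + t powr (1 - p) * u powr p"
proof (cases "u \<le> t")
  case True
  then show ?thesis by (simp add: add_increasing2)
next
  case False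
  then have "u = u powr (1 - p) * u powr p"
    using assms by (simp flip: powr_add)
  also have "\<dots> \<le> t powr (1 - p) * u powr p"
    using False assms by (intro mult_right_mono powr_mono2') auto
  finally show ?thesis using assms by simp
qed

lemma emeasure_lebesgue_ball:
  fixes x :: "real ^ 'n"
  assumes "0 \<le> r"
  shows "emeasure lebesgue (ball x r) = ennreal (unit_ball_vol (real CARD('n)) * r ^ CARD('n))"
  using emeasure_ball[OF assms, of x] by (simp add: DIM_cart)

text \<open>Young's inequality with the scale \<open>t = R powr ((l - n) / p) * K\<close> balances the
  two contributions and takes the place of Hoelder's inequality.\<close>

lemma nn_integral_norm_ball_le:
  fixes f :: "real ^ 'n \<Rightarrow> 'b::{real_normed_field, euclidean_space}"
  assumes "1 < p" and f: "locally_p_integrable p f" and "R > 0" and "K > 0"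
    and le: "morrey_modulus p l f x R \<le> K powr p"
  shows "(\<integral>\<^sup>+ y \<in> ball x R. ennreal (norm (f y)) \<partial>lebesgue)
    \<le> ennreal ((unit_ball_vol (real CARD('n)) + 1) * R ^ CARD('n)
        * (R powr ((l - real CARD('n)) / p) * K))"
proof -
  define n where "n = CARD('n)"
  define t where "t = R powr ((l - real n) / p) * K"
  define w where "w = unit_ball_vol (real n)"
  have [measurable]: "f \<in> borel_measurable lebesgue"
    using f by (simp add: locally_p_integrable_def)
  have t: "t > 0" using assms by (simp add: t_def)
  have w: "w \<ge> 0" by (simp add: w_def)
  have "(\<integral>\<^sup>+ y \<in> ball x R. ennreal (norm (f y)) \<partial>lebesgue)
    \<le> (\<integral>\<^sup>+ y. ennreal t * indicator (ball x R) y
        + ennreal (t powr (1 - p)) * (ennreal (norm (f y) powr p) * indicator (ball x R) y) \<partial>lebesgue)"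
  proof (intro nn_integral_mono)
    fix y
    have "ennreal (norm (f y)) \<le> ennreal t + ennreal (t powr (1 - p)) * ennreal (norm (f y) powr p)"
      using le_add_powr_scaled[of "norm (f y)" t p] t assms(1)
      by (simp flip: ennreal_plus ennreal_mult)
    then show "ennreal (norm (f y)) * indicator (ball x R) y \<le> ennreal t * indicator (ball x R) y
        + ennreal (t powr (1 - p)) * (ennreal (norm (f y) powr p) * indicator (ball x R) y)"
      by (auto simp: indicator_def)
  qed
  also have "\<dots> = ennreal t * emeasure lebesgue (ball x R)
      + ennreal (t powr (1 - p)) * (\<integral>\<^sup>+ y \<in> ball x R. ennreal (norm (f y) powr p) \<partial>lebesgue)"
    by (subst nn_integral_add) (auto simp: nn_integral_cmult nn_integral_cmult_indicator)
  also have "\<dots> = ennreal (t * (w * R ^ n) + t powr (1 - p) * (R powr l * morrey_modulus p l f x R))"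
    unfolding nn_integral_ball_eq_morrey_modulus[OF f \<open>R > 0\<close>, of x l]
    using \<open>R > 0\<close> t w
    by (simp add: emeasure_lebesgue_ball n_def w_def morrey_modulus_nonneg
        del: emeasure_completion flip: ennreal_plus ennreal_mult)
  also have "\<dots> \<le> ennreal (t * (w * R ^ n) + t powr (1 - p) * (R powr l * K powr p))"
    using le by (intro ennreal_leI add_left_mono mult_left_mono) auto
  \<comment> \<open>By the choice of \<open>t\<close>, \<open>t powr (- p)\<close> equals
    \<open>R powr (n - l) * K powr (- p)\<close>. This cancels \<open>K powr p\<close> and turns
    \<open>R powr l\<close> into \<open>R ^ n\<close>, the same order as the volume term.\<close>
  also have "t powr (1 - p) * (R powr l * K powr p) = R ^ n * t"
  proof -
    have "t powr (1 - p) = t * t powr (- p)"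
      using t powr_add[of t 1 "- p"] by simp
    also have "t powr (- p) = R powr (real n - l) * K powr (- p)"
      using assms by (simp add: t_def powr_mult powr_powr)
    finally have "t powr (1 - p) * (R powr l * K powr p)
        = t * (R powr (real n - l) * R powr l) * (K powr (- p) * K powr p)"
      by (simp add: ac_simps)
    also have "\<dots> = R ^ n * t"
      using assms by (simp add: powr_realpow flip: powr_add)
    finally show ?thesis .
  qed
  finally show ?thesis
    unfolding t_def[symmetric] n_def[symmetric] w_def[symmetric] by (simp add: algebra_simps)
qed

section \<open>Dyadic estimate of the tail integral\<close>

text \<open>Take the least \<open>j\<close> with \<open>d < 2 ^ j * r\<close>. As
  \<open>2 * r \<le> d\<close> excludes 0 and 1, it has the form \<open>Suc (Suc k)\<close>, and
  minimality gives the lower bound.\<close>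

lemma exists_dyadic_annulus:
  fixes d r :: real
  assumes "0 < r" and "2 * r \<le> d"
  obtains k where "2 ^ Suc k * r \<le> d" and "d < 2 ^ Suc (Suc k) * r"
proof -
  obtain m :: nat where m: "d / r < 2 ^ m"
    using real_arch_pow[of 2 "d / r"] by auto
  define P where "P j \<longleftrightarrow> d < 2 ^ j * r" for j :: nat
  have "P m" using m \<open>0 < r\<close> by (simp add: P_def field_simps)
  then have P: "P (LEAST j. P j)" by (rule LeastI)
  have not1: "\<not> P 0" "\<not> P 1" using assms by (auto simp: P_def)
  obtain k where k: "(LEAST j. P j) = Suc (Suc k)"
    using P not1 by (metis One_nat_def not0_implies_Suc)
  have "\<not> P (Suc k)"
    using not_less_Least[of "Suc k" P] k by simp
  with P k show ?thesis
    by (intro that[of k]) (auto simp: P_def)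
qed

text \<open>On the annulus with outer radius \<open>R k\<close> the kernel is at most
  \<open>(4 / R k) ^ n\<close>. The bound for the integral of \<open>norm (f y)\<close> over
  \<open>ball x (R k)\<close> carries a factor \<open>R k ^ n\<close>, which cancels. What remains
  is at most a multiple of \<open>q ^ k\<close>, with \<open>q < 1\<close> because
  \<open>l < n\<close>. The constant is independent of \<open>f\<close>, \<open>x\<close>,
  \<open>z\<close>, \<open>r\<close> and \<open>K\<close>.\<close>

lemma nn_integral_tail_le:
  fixes f :: "real ^ 'n \<Rightarrow> 'b::{real_normed_field, euclidean_space}"
  assumes "1 < p" and "l < real CARD('n)" and f: "locally_p_integrable p f"
    and "r > 0" and "K > 0" and z: "z \<in> ball x r"
    and le: "\<And>s. 2 * r \<le> s \<Longrightarrow> morrey_modulus p l f x s \<le> K powr p"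
  defines "q \<equiv> 2 powr ((l - real CARD('n)) / p)"
  shows "(\<integral>\<^sup>+ y \<in> - ball x (2 * r). ennreal (norm (f y) / norm (y - z) ^ CARD('n)) \<partial>lebesgue)
    \<le> ennreal (4 ^ CARD('n) * (unit_ball_vol (real CARD('n)) + 1) / (1 - q)
        * (r powr ((l - real CARD('n)) / p) * K))"
proof -
  define n where "n = CARD('n)"
  define w where "w = unit_ball_vol (real n)"
  define e where "e = (l - real n) / p"
  define R where "R k = 2 ^ Suc (Suc k) * r" for k :: nat
  define B where "B = 4 ^ n * (w + 1) * (r powr e * K)"
  have [measurable]: "f \<in> borel_measurable lebesgue"
    using f by (simp add: locally_p_integrable_def)
  have w: "w \<ge> 0" by (simp add: w_def)
  have B: "B \<ge> 0" using w assms by (simp add: B_def)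
  have "e < 0" using assms by (simp add: e_def n_def divide_neg_pos)
  then have q: "0 < q" "q < 1"
    using powr_less_mono[of e 0 2] by (auto simp: q_def e_def n_def)
  have R: "R k > 0" "2 * r \<le> R k" for k
    using \<open>r > 0\<close> one_le_power[of "2::real" "Suc k"] by (auto simp: R_def)
  \<comment> \<open>Each annulus is enlarged to the full ball \<open>ball x (R k)\<close>, to which
    the modulus bound applies directly; the overlaps do no harm to an upper bound.\<close>
  have pointwise: "ennreal (norm (f y) / norm (y - z) ^ n) * indicator (- ball x (2 * r)) y
      \<le> (\<Sum>k. ennreal (4 ^ n / R k ^ n) * (ennreal (norm (f y)) * indicator (ball x (R k)) y))"
    (is "?L \<le> (\<Sum>k. ?S k)") for y
  proof (cases "y \<in> ball x (2 * r)")
    case False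
    then obtain k where k: "2 ^ Suc k * r \<le> dist x y" "dist x y < 2 ^ Suc (Suc k) * r"
      using exists_dyadic_annulus[OF \<open>r > 0\<close>, of "dist x y"] by auto
    \<comment> \<open>Since \<open>dist x z < r\<close> and \<open>r\<close> is at most half of
      \<open>dist x y\<close>, \<open>norm (y - z)\<close> exceeds half of \<open>dist x y\<close>,
      hence \<open>R k / 4\<close>.\<close>
    have "dist x y \<le> dist x z + norm (y - z)"
      by (metis dist_commute dist_norm dist_triangle)
    then have *: "R k / 4 \<le> norm (y - z)"
      using k z False by (auto simp: R_def)
    have "0 < norm (y - z)"
      using * R(1)[of k] by linarith
    from * have "(R k / 4) ^ n \<le> norm (y - z) ^ n"
      using R(1)[of k] by (intro power_mono) auto
    then have "norm (f y) / norm (y - z) ^ n \<le> norm (f y) / (R k / 4) ^ n"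
      using R(1)[of k] \<open>0 < norm (y - z)\<close>
      by (intro divide_left_mono mult_pos_pos zero_less_power) auto
    also have "\<dots> = 4 ^ n / R k ^ n * norm (f y)"
      by (simp add: power_divide)
    finally have "?L \<le> ?S k"
      using False k R(1)[of k] by (auto simp: R_def simp flip: ennreal_mult intro!: ennreal_leI)
    also have "?S k \<le> (\<Sum>k. ?S k)"
      using sum_le_suminf[of ?S "{k}"] by simp
    finally show ?thesis .
  qed simp
  have "(\<integral>\<^sup>+ y \<in> - ball x (2 * r). ennreal (norm (f y) / norm (y - z) ^ n) \<partial>lebesgue)
    \<le> (\<integral>\<^sup>+ y. (\<Sum>k. ennreal (4 ^ n / R k ^ n) * (ennreal (norm (f y)) * indicator (ball x (R k)) y)) \<partial>lebesgue)"
    by (intro nn_integral_mono pointwise)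
  also have "\<dots> = (\<Sum>k. ennreal (4 ^ n / R k ^ n) * (\<integral>\<^sup>+ y \<in> ball x (R k). ennreal (norm (f y)) \<partial>lebesgue))"
    by (subst nn_integral_suminf) (auto simp: nn_integral_cmult)
  also have "\<dots> \<le> (\<Sum>k. ennreal (B * q ^ k))"
  proof (intro suminf_le)
    fix k
    have "R k powr e = q ^ k * (2 powr (2 * e) * r powr e)"
    proof -
      have "R k = 2 powr (real k + 2) * r"
        by (simp add: R_def powr_add powr_realpow)
      then have "R k powr e = 2 powr (e * real k) * 2 powr (2 * e) * r powr e"
        using \<open>r > 0\<close> by (simp add: powr_mult powr_powr algebra_simps flip: powr_add)
      also have "2 powr (e * real k) = q ^ k"
        using q powr_realpow[of q k] powr_powr[of 2 e "real k"] by (simp add: q_def e_def n_def)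
      finally show ?thesis by simp
    qed
    \<comment> \<open>The factor \<open>2 powr (2 * e)\<close>, which stems from the shift in
      \<open>Suc (Suc k)\<close>, is at most 1 because \<open>e < 0\<close>.\<close>
    also have "\<dots> \<le> q ^ k * (1 * r powr e)"
      using \<open>e < 0\<close> q powr_mono[of "2 * e" 0 2] by (intro mult_left_mono mult_right_mono) auto
    finally have Re: "R k powr e \<le> q ^ k * r powr e" by simp
    have "ennreal (4 ^ n / R k ^ n) * (\<integral>\<^sup>+ y \<in> ball x (R k). ennreal (norm (f y)) \<partial>lebesgue)
      \<le> ennreal (4 ^ n / R k ^ n) * ennreal ((w + 1) * R k ^ n * (R k powr e * K))"
      using nn_integral_norm_ball_le[OF \<open>1 < p\<close> f R(1)[of k] \<open>K > 0\<close> le[OF R(2)]]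
      by (intro mult_left_mono) (auto simp: w_def n_def e_def)
    also have "\<dots> = ennreal (4 ^ n * (w + 1) * K * (R k powr e))"
      using R(1)[of k] w \<open>K > 0\<close> by (simp add: field_simps flip: ennreal_mult)
    also have "\<dots> \<le> ennreal (4 ^ n * (w + 1) * K * (q ^ k * r powr e))"
      using Re w \<open>K > 0\<close> by (intro ennreal_leI mult_left_mono) auto
    also have "4 ^ n * (w + 1) * K * (q ^ k * r powr e) = B * q ^ k"
      by (simp add: B_def)
    finally show "ennreal (4 ^ n / R k ^ n) * (\<integral>\<^sup>+ y \<in> ball x (R k). ennreal (norm (f y)) \<partial>lebesgue)
      \<le> ennreal (B * q ^ k)" .
  qed auto
  also have "\<dots> = ennreal (B * (1 / (1 - q)))"
    using q B sums_mult[OF geometric_sums[of q], of B]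
    by (subst suminf_ennreal2) (auto simp: sums_iff)
  finally show ?thesis
    by (simp add: B_def w_def n_def e_def mult_ac)
qed

section \<open>The local estimate for the operator\<close>

text \<open>Raising the norm inequality to the power \<open>p\<close>, and its constant with it,
  gives a form that combines additively with the pointwise bound for the far part.\<close>

lemma Lp_bounded_nn_integral_le:
  fixes T :: "(real ^ 'n \<Rightarrow> 'b::{real_normed_field, euclidean_space}) \<Rightarrow> real ^ 'n \<Rightarrow> 'b"
  assumes "1 < p" and "Lp_bounded p T"
  obtains C where "C > 0" and "\<And>g. g \<in> Lp_space p \<Longrightarrow>
    (\<integral>\<^sup>+ y. ennreal (norm (T g y) powr p) \<partial>lebesgue)
      \<le> ennreal C * (\<integral>\<^sup>+ y. ennreal (norm (g y) powr p) \<partial>lebesgue)"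
proof -
  obtain C where C: "C > 0" "\<And>g. g \<in> Lp_space p \<Longrightarrow> Lp_norm p (T g) \<le> C * Lp_norm p g"
    and Tg: "\<And>g. g \<in> Lp_space p \<Longrightarrow> T g \<in> Lp_space p"
    using assms by (auto simp: Lp_bounded_def)
  have Lp: "(\<integral>\<^sup>+ y. ennreal (norm (h y) powr p) \<partial>lebesgue) = ennreal (Lp_norm p h powr p)"
    if "h \<in> Lp_space p" for h :: "real ^ 'n \<Rightarrow> 'b"
    using that \<open>1 < p\<close>
    by (subst nn_integral_eq_integral) (auto simp: Lp_space_def Lp_norm_def powr_powr)
  have nonneg: "0 \<le> Lp_norm p h" for h :: "real ^ 'n \<Rightarrow> 'b"
    by (simp add: Lp_norm_def)
  show ?thesis
  proof (rule that[of "C powr p"])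
    fix g :: "real ^ 'n \<Rightarrow> 'b"
    assume g: "g \<in> Lp_space p"
    have "Lp_norm p (T g) powr p \<le> (C * Lp_norm p g) powr p"
      using C(2)[OF g] \<open>1 < p\<close> nonneg by (intro powr_mono2) auto
    then show "(\<integral>\<^sup>+ y. ennreal (norm (T g y) powr p) \<partial>lebesgue)
        \<le> ennreal (C powr p) * (\<integral>\<^sup>+ y. ennreal (norm (g y) powr p) \<partial>lebesgue)"
      using C(1) nonneg by (simp add: Lp g Tg powr_mult flip: ennreal_mult)
  qed (use C in auto)
qed

text \<open>One constant serves all \<open>f\<close>, \<open>x\<close>, \<open>r\<close> and
  \<open>K\<close>, and the hypothesis concerns the single centre \<open>x\<close>. \<open>K\<close>
  is strictly positive because it enters the scale in Young's inequality.\<close>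

lemma morrey_modulus_operator_le:
  fixes T :: "(real ^ 'n \<Rightarrow> 'b::{real_normed_field, euclidean_space}) \<Rightarrow> real ^ 'n \<Rightarrow> 'b"
  assumes "1 < p" and "l < real CARD('n)"
    and D: "Lp_space p \<union> morrey_space p l \<subseteq> D"
    and T: "p_admissible_singular p D T"
  obtains C where "C > 0"
    and "\<And>f x r K. \<lbrakk>f \<in> morrey_space p l; r > 0; K > 0;
        \<And>s. 2 * r \<le> s \<Longrightarrow> morrey_modulus p l f x s \<le> K powr p\<rbrakk> \<Longrightarrow>
      set_integrable lebesgue (ball x r) (\<lambda>y. norm (T f y) powr p)"
    and "\<And>f x r K. \<lbrakk>f \<in> morrey_space p l; r > 0; K > 0;
        \<And>s. 2 * r \<le> s \<Longrightarrow> morrey_modulus p l f x s \<le> K powr p\<rbrakk> \<Longrightarrow>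
      morrey_modulus p l (T f) x r \<le> (C * K) powr p"
proof -
  have sub: "sublinear_on D T" and bdd: "Lp_bounded p T" and size: "size_condition_on D T"
    using T by (auto simp: p_admissible_singular_def)
  obtain C0 where C0: "C0 > 0" and Lp: "\<And>g. g \<in> Lp_space p \<Longrightarrow>
      (\<integral>\<^sup>+ y. ennreal (norm (T g y) powr p) \<partial>lebesgue)
        \<le> ennreal C0 * (\<integral>\<^sup>+ y. ennreal (norm (g y) powr p) \<partial>lebesgue)"
    using Lp_bounded_nn_integral_le[OF \<open>1 < p\<close> bdd] by blast
  obtain c where c: "c > 0" and size_le: "\<And>f x r. \<lbrakk>f \<in> D; r > 0; restrict_fun (- ball x (2 * r)) f \<in> D\<rbrakk> \<Longrightarrow>
      AE z in lebesgue. indicator (ball x r) z * ennreal (norm (T (restrict_fun (- ball x (2 * r)) f) z))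
        \<le> ennreal c * indicator (ball x r) z *
          (\<integral>\<^sup>+ y \<in> - ball x (2 * r). ennreal (norm (f y) / norm (y - z) ^ CARD('n)) \<partial>lebesgue)"
    using size unfolding size_condition_on_def by blast
  define n where "n = CARD('n)"
  define e where "e = (l - real n) / p"
  define w where "w = unit_ball_vol (real n)"
  define G where "G = 4 ^ n * (w + 1) / (1 - 2 powr e)"
  \<comment> \<open>\<open>2 powr p\<close> comes from splitting the power of a sum,
    \<open>C0 * 2 powr l\<close> from the near part on the ball of radius \<open>2 * r\<close>, and
    \<open>(c * G) powr p * w\<close> from the far part, with \<open>G\<close> the constant of the
    tail estimate.\<close>
  define C1 where "C1 = 2 powr p * (C0 * 2 powr l + (c * G) powr p * w)"
  have w: "w > 0" by (simp add: w_def)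
  have "e < 0" using assms by (simp add: e_def n_def divide_neg_pos)
  then have G: "G > 0"
    using w powr_less_mono[of e 0 2] by (simp add: G_def add_pos_pos)
  have C1: "C1 > 0"
    unfolding C1_def using C0 w by (intro mult_pos_pos add_pos_nonneg) auto
  have main: "(\<integral>\<^sup>+ z \<in> ball x r. ennreal (norm (T f z) powr p) \<partial>lebesgue)
      \<le> ennreal (r powr l * (C1 powr (1 / p) * K) powr p)"
    if f: "f \<in> morrey_space p l" and r: "r > 0" and K: "K > 0"
      and le: "\<And>s. 2 * r \<le> s \<Longrightarrow> morrey_modulus p l f x s \<le> K powr p" for f x r K
  proof -
    define g where "g = restrict_fun (ball x (2 * r)) f"
    define h where "h = restrict_fun (- ball x (2 * r)) f"
    have loc: "locally_p_integrable p f" using f by (simp add: morrey_space_def)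
    have "f \<in> D" using f D by auto
    have gL: "g \<in> Lp_space p"
      unfolding g_def by (rule restrict_fun_ball_in_Lp_space[OF loc])
    then have "g \<in> D" using D by auto
    \<comment> \<open>The far part need not lie in \<open>Lp_space p\<close> in general, so it
      enters \<open>D\<close> through the Morrey space.\<close>
    have "h \<in> morrey_space p l"
      unfolding h_def by (intro restrict_fun_in_morrey_space[OF \<open>1 < p\<close> f]) auto
    then have "h \<in> D" using D by auto
    have f_eq: "(\<lambda>y. g y + h y) = f"
      unfolding g_def h_def by (rule restrict_fun_add_compl)
    have [measurable]: "T f \<in> borel_measurable lebesgue" "T g \<in> borel_measurable lebesgue"
      using sub \<open>f \<in> D\<close> \<open>g \<in> D\<close> by (auto simp: sublinear_on_def)
    have AE_add: "AE z in lebesgue. norm (T f z) \<le> norm (T g z) + norm (T h z)"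
    proof -
      have "(\<lambda>y. g y + h y) \<in> D \<longrightarrow>
          (AE z in lebesgue. norm (T (\<lambda>y. g y + h y) z) \<le> norm (T g z) + norm (T h z))"
        using sub \<open>g \<in> D\<close> \<open>h \<in> D\<close> unfolding sublinear_on_def by blast
      then show ?thesis unfolding f_eq using \<open>f \<in> D\<close> by (rule mp)
    qed
    \<comment> \<open>A bound for \<open>T h\<close> that is uniform on \<open>ball x r\<close>: the
      size condition followed by the tail estimate.\<close>
    define H where "H = c * (G * (r powr e * K))"
    have H: "H \<ge> 0" using c G K by (simp add: H_def)
    have AE_h: "AE z in lebesgue. z \<in> ball x r \<longrightarrow> norm (T h z) \<le> H"
      using size_le[OF \<open>f \<in> D\<close> r \<open>h \<in> D\<close>[unfolded h_def]] unfolding h_def[symmetric]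
    proof eventually_elim
      case (elim z)
      show ?case
      proof
        assume z: "z \<in> ball x r"
        have "ennreal (norm (T h z)) \<le> ennreal c *
          (\<integral>\<^sup>+ y \<in> - ball x (2 * r). ennreal (norm (f y) / norm (y - z) ^ CARD('n)) \<partial>lebesgue)"
          using elim z by simp
        also have "\<dots> \<le> ennreal c * ennreal (G * (r powr e * K))"
          using nn_integral_tail_le[OF assms(1,2) loc r K z le]
          by (intro mult_left_mono) (auto simp: G_def w_def e_def n_def)
        also have "\<dots> = ennreal H"
          using c G K by (simp add: H_def flip: ennreal_mult)
        finally show "norm (T h z) \<le> H" using H by simp
      qed
    qed
    \<comment> \<open>The term with \<open>T g\<close> is integrated over the whole space, as the
      \<open>Lp\<close> bound requires; the term with \<open>H\<close> keeps its indicator, so that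
      it contributes only the volume of the ball.\<close>
    have "(\<integral>\<^sup>+ z \<in> ball x r. ennreal (norm (T f z) powr p) \<partial>lebesgue)
      \<le> (\<integral>\<^sup>+ z. ennreal (2 powr p) * (ennreal (norm (T g z) powr p)
          + ennreal (H powr p) * indicator (ball x r) z) \<partial>lebesgue)"
      using AE_add AE_h
    proof (intro nn_integral_mono_AE, eventually_elim)
      case (elim z)
      show ?case
      proof (cases "z \<in> ball x r")
        case True
        have "norm (T f z) powr p \<le> (norm (T g z) + H) powr p"
          using elim True \<open>1 < p\<close> by (intro powr_mono2) auto
        also have "\<dots> \<le> 2 powr p * (norm (T g z) powr p + H powr p)"
          using H \<open>1 < p\<close> by (intro powr_add_le) auto
        finally show ?thesis
          using True by (simp flip: ennreal_plus ennreal_mult)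
      qed simp
    qed
    also have "\<dots> = ennreal (2 powr p) * ((\<integral>\<^sup>+ z. ennreal (norm (T g z) powr p) \<partial>lebesgue)
        + ennreal (H powr p) * emeasure lebesgue (ball x r))"
      by (simp add: nn_integral_cmult nn_integral_add nn_integral_cmult_indicator del: emeasure_completion)
    also have "\<dots> \<le> ennreal (2 powr p) * (ennreal (C0 * ((2 * r) powr l * K powr p))
        + ennreal (H powr p) * ennreal (w * r ^ n))"
    proof (intro mult_left_mono add_mono)
      have "(\<integral>\<^sup>+ z. ennreal (norm (g z) powr p) \<partial>lebesgue)
        = (\<integral>\<^sup>+ z \<in> ball x (2 * r). ennreal (norm (f z) powr p) \<partial>lebesgue)"
        unfolding g_def norm_restrict_fun_powr
        by (intro nn_integral_cong) (auto simp: indicator_def)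
      also have "\<dots> = ennreal ((2 * r) powr l * morrey_modulus p l f x (2 * r))"
        using r by (intro nn_integral_ball_eq_morrey_modulus[OF loc]) auto
      also have "\<dots> \<le> ennreal ((2 * r) powr l * K powr p)"
        using le[of "2 * r"] by (intro ennreal_leI mult_left_mono) auto
      finally have "ennreal C0 * (\<integral>\<^sup>+ z. ennreal (norm (g z) powr p) \<partial>lebesgue)
        \<le> ennreal C0 * ennreal ((2 * r) powr l * K powr p)"
        by (intro mult_left_mono) auto
      also have "\<dots> = ennreal (C0 * ((2 * r) powr l * K powr p))"
        using C0 by (simp flip: ennreal_mult)
      finally show "(\<integral>\<^sup>+ z. ennreal (norm (T g z) powr p) \<partial>lebesgue)
          \<le> ennreal (C0 * ((2 * r) powr l * K powr p))"
        using Lp[OF gL] by (rule order_trans[rotated])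
      show "emeasure lebesgue (ball x r) \<le> ennreal (w * r ^ n)"
        using emeasure_lebesgue_ball[of r x] r by (simp add: w_def n_def)
    qed auto
    also have "\<dots> = ennreal (2 powr p * (C0 * ((2 * r) powr l * K powr p) + H powr p * (w * r ^ n)))"
      using C0 w r by (simp flip: ennreal_plus ennreal_mult)
    also have "2 powr p * (C0 * ((2 * r) powr l * K powr p) + H powr p * (w * r ^ n))
        = r powr l * (C1 powr (1 / p) * K) powr p"
    proof -
      \<comment> \<open>The far part carries \<open>r powr (l - n)\<close>; multiplied by the volume
        factor \<open>r ^ n\<close>, it scales like \<open>r powr l\<close>, as the near part
        does.\<close>
      have "H powr p = (c * G) powr p * (r powr (l - real n) * K powr p)"
        using c G K r \<open>1 < p\<close> by (simp add: H_def powr_mult powr_powr e_def)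
      then have "H powr p * (w * r ^ n)
          = (c * G) powr p * w * (r powr (l - real n) * r powr real n) * K powr p"
        using r by (simp add: powr_realpow)
      also have "r powr (l - real n) * r powr real n = r powr l"
        by (simp flip: powr_add)
      finally have "H powr p * (w * r ^ n) = (c * G) powr p * w * r powr l * K powr p" .
      moreover have "(C1 powr (1 / p) * K) powr p = C1 * K powr p"
        using C1 K \<open>1 < p\<close> by (simp add: powr_mult powr_powr)
      ultimately show ?thesis
        using r by (simp add: C1_def powr_mult algebra_simps)
    qed
    finally show ?thesis .
  qed
  have meas: "T f \<in> borel_measurable lebesgue" if "f \<in> morrey_space p l" for f
    using sub D that by (auto simp: sublinear_on_def)
  show ?thesis
  proof (rule that[of "C1 powr (1 / p)"])
    fix f :: "real ^ 'n \<Rightarrow> 'b" and x r K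
    assume A: "f \<in> morrey_space p l" "r > 0" "K > 0"
      "\<And>s. 2 * r \<le> s \<Longrightarrow> morrey_modulus p l f x s \<le> K powr p"
    note * = morrey_modulus_le_of_nn_integral[OF meas[OF A(1)] A(2) _ main[OF A]]
    show "set_integrable lebesgue (ball x r) (\<lambda>y. norm (T f y) powr p)"
      by (rule *(1)) auto
    show "morrey_modulus p l (T f) x r \<le> (C1 powr (1 / p) * K) powr p"
      by (rule *(2)) auto
  qed (use C1 in auto)
qed

section \<open>Norm bound and decay at infinity\<close>

theorem theorem3p1:
  fixes p l :: real
    and D :: "(real ^ 'n \<Rightarrow> 'b::{real_normed_field, euclidean_space}) set"
    and T :: "(real ^ 'n \<Rightarrow> 'b) \<Rightarrow> real ^ 'n \<Rightarrow> 'b"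
  assumes "1 < p"
    and "0 \<le> l" and "l < real CARD('n)"
    and "Lp_space p \<union> morrey_space p l \<subseteq> D"
    and "p_admissible_singular p D T"
  shows "(\<forall>f \<in> vanishing_morrey_space_infty p l. T f \<in> vanishing_morrey_space_infty p l) \<and>
    (\<exists>C>0. \<forall>f \<in> vanishing_morrey_space_infty p l.
       morrey_norm p l (T f) \<le> C * morrey_norm p l f)"
proof -
  obtain C where C: "C > 0"
    and int: "\<And>f x r K. \<lbrakk>f \<in> morrey_space p l; r > 0; K > 0;
        \<And>s. 2 * r \<le> s \<Longrightarrow> morrey_modulus p l f x s \<le> K powr p\<rbrakk> \<Longrightarrow>
      set_integrable lebesgue (ball x r) (\<lambda>y. norm (T f y) powr p)"
    and le: "\<And>f x r K. \<lbrakk>f \<in> morrey_space p l; r > 0; K > 0;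
        \<And>s. 2 * r \<le> s \<Longrightarrow> morrey_modulus p l f x s \<le> K powr p\<rbrakk> \<Longrightarrow>
      morrey_modulus p l (T f) x r \<le> (C * K) powr p"
    by (rule morrey_modulus_operator_le[OF assms(1,3,4,5)]) blast
  have norm_nonneg: "0 \<le> morrey_norm p l f" if "f \<in> morrey_space p l"
    for f :: "real ^ 'n \<Rightarrow> 'b"
    using morrey_modulus_le_norm(1)[OF assms(1) that, of 1] by (rule order_trans[rotated]) auto
  have mod_le: "morrey_modulus p l f x s \<le> K powr p"
    if "f \<in> morrey_space p l" "morrey_norm p l f \<le> K" "s > 0" for f :: "real ^ 'n \<Rightarrow> 'b" and x s K
  proof -
    have "morrey_norm p l f powr p \<le> K powr p"
      using that norm_nonneg assms(1) by (intro powr_mono2) auto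
    with morrey_modulus_le_norm(2)[OF assms(1) that(1,3), of x] show ?thesis by linarith
  qed
  have space: "T f \<in> morrey_space p l" if f: "f \<in> morrey_space p l" for f
  proof -
    \<comment> \<open>Adding 1 keeps \<open>K\<close> positive even when the norm of
      \<open>f\<close> is 0.\<close>
    define K where "K = morrey_norm p l f + 1"
    have K: "K > 0" "morrey_norm p l f \<le> K" using norm_nonneg[OF f] by (auto simp: K_def)
    have meas: "T f \<in> borel_measurable lebesgue"
      using assms(4,5) f by (auto simp: p_admissible_singular_def sublinear_on_def)
    show ?thesis
      using K mod_le[OF f K(2)]
      by (intro morrey_spaceI[OF assms(1), where B = "(C * K) powr p"]
          locally_p_integrableI_ball[OF meas] int[OF f _ K(1)] le[OF f _ K(1)]) auto
  qed
  have bound: "morrey_norm p l (T f) \<le> C * morrey_norm p l f" if f: "f \<in> morrey_space p l" for f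
  \<comment> \<open>The norm of \<open>f\<close> may be 0 whereas the local estimate asks for
    \<open>K > 0\<close>; hence the bound is shown for every \<open>M\<close> above
    \<open>C * morrey_norm p l f\<close>, with \<open>K = M / C\<close>.\<close>
  proof (rule dense_ge)
    fix M
    assume M: "C * morrey_norm p l f < M"
    define K where "K = M / C"
    have "morrey_norm p l f < K" using M C by (simp add: K_def field_simps)
    then have K: "K > 0" "morrey_norm p l f \<le> K" using norm_nonneg[OF f] by auto
    show "morrey_norm p l (T f) \<le> M"
      unfolding morrey_norm_def
    proof (rule cSUP_least)
      fix z :: "(real ^ 'n) \<times> real"
      assume "z \<in> UNIV \<times> {0<..}"
      then obtain x r where z: "z = (x, r)" "r > 0" by auto
      have "morrey_modulus p l (T f) x r powr (1 / p) \<le> ((C * K) powr p) powr (1 / p)"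
        using z K assms(1) by (intro powr_mono2 le[OF f _ K(1)] mod_le[OF f K(2)] morrey_modulus_nonneg) auto
      also have "\<dots> = M" using C K(1) assms(1) by (simp add: powr_powr K_def zero_less_divide_iff)
      finally show "(case z of (x, r) \<Rightarrow> morrey_modulus p l (T f) x r powr (1 / p)) \<le> M"
        by (simp add: z)
    qed auto
  qed
  \<comment> \<open>Boundedness over all centres is what makes the real-valued supremum an actual
    upper bound.\<close>
  have bdd: "bdd_above (range (\<lambda>x. morrey_modulus p l f x r))"
    if "f \<in> morrey_space p l" "r > 0" for f :: "real ^ 'n \<Rightarrow> 'b" and r
    using mod_le[OF that(1) order_refl that(2)] by (rule bdd_aboveI2)
  have vanishing: "T f \<in> vanishing_morrey_space_infty p l"
    if f: "f \<in> vanishing_morrey_space_infty p l" for f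
  proof -
    have fM: "f \<in> morrey_space p l"
      and lim: "((\<lambda>r. SUP x. morrey_modulus p l f x r) \<longlongrightarrow> 0) at_top"
      using f by (auto simp: vanishing_morrey_space_infty_def)
    have "((\<lambda>r. SUP x. morrey_modulus p l (T f) x r) \<longlongrightarrow> 0) at_top"
    proof (rule tendstoI)
      fix \<epsilon> :: real
      assume "\<epsilon> > 0"
      \<comment> \<open>Chosen so that the local estimate yields exactly \<epsilon> / 2; the half
        restores the strict inequality after taking the supremum over \<open>x\<close>.\<close>
      define K where "K = (\<epsilon> / 2) powr (1 / p) / C"
      have K: "K > 0" "(C * K) powr p = \<epsilon> / 2"
        using \<open>\<epsilon> > 0\<close> C assms(1) by (auto simp: K_def powr_powr)
      have "\<forall>\<^sub>F r in at_top. (SUP x. morrey_modulus p l f x r) < K powr p"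
        using lim K(1) by (intro order_tendstoD(2)) auto
      then obtain r0 where r0: "\<And>s. s \<ge> r0 \<Longrightarrow> (SUP x. morrey_modulus p l f x s) < K powr p"
        by (auto simp: eventually_at_top_linorder)
      show "\<forall>\<^sub>F r in at_top. dist (SUP x. morrey_modulus p l (T f) x r) 0 < \<epsilon>"
        \<comment> \<open>The 1 guarantees \<open>r > 0\<close>, and \<open>r \<ge> r0\<close> puts
          every radius \<open>s \<ge> 2 * r\<close> into the range where the modulus of
          \<open>f\<close> is small.\<close>
        using eventually_ge_at_top[of "max 1 r0"]
      proof eventually_elim
        case (elim r)
        have "morrey_modulus p l f x s \<le> K powr p" if "2 * r \<le> s" for x s
          using cSUP_upper[OF UNIV_I bdd[OF fM], of s x] r0[of s] that elim by auto
        then have "morrey_modulus p l (T f) x r \<le> \<epsilon> / 2" for x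
          using le[OF fM _ K(1), of r x] elim K(2) by auto
        then have "(SUP x. morrey_modulus p l (T f) x r) \<le> \<epsilon> / 2"
          by (intro cSUP_least) auto
        moreover have "0 \<le> (SUP x. morrey_modulus p l (T f) x r)"
          using elim by (intro cSUP_upper2[OF bdd[OF space[OF fM]], of _ 0] morrey_modulus_nonneg) auto
        ultimately show ?case using \<open>\<epsilon> > 0\<close> by simp
      qed
    qed
    with space[OF fM] show ?thesis by (simp add: vanishing_morrey_space_infty_def)
  qed
  show ?thesis
    using C bound vanishing by (auto simp: vanishing_morrey_space_infty_def)
qed

end
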